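(* Let $\mathcal{H}$ be a reproducing kernel Hilbert space on a nonempty set $\Omega$ and let $A=\begin{bmatrix}A_{11}&A_{12}\\ A_{21}&A_{22}\end{bmatrix}\in\mathbb{B}(\mathcal{H}\oplus\mathcal{H})$ with $A_{ij}\in\mathbb{B}(\mathcal{H})$. Then $$\mathbf{ber}(A)\le\frac12\Bigg(\mathbf{ber}(A_{11})+\mathbf{ber}(A_{22})+\sqrt{\big(\mathbf{ber}(A_{11})-\mathbf{ber}(A_{22})\big)^2+\big\||A_{12}|+|A_{21}^*|\big\|_{ber}\,\big\||A_{21}|+|A_{12}^*|\big\|_{ber}}\Bigg).$$
   Context: A reproducing kernel Hilbert space (RKHS) $\mathcal{H}$ on a nonempty set $\Omega$ is a complex Hilbert space of complex-valued functions on $\Omega$ for which every evaluation $f\mapsto f(\lambda)$, $\lambda\in\Omega$, is a bounded linear functional; $k_\lambda\in\mathcal{H}$ is the unique element with $f(\lambda)=\langle f,k_\lambda\rangle$ for all $f\in\mathcal{H}$, it is assumed that $k_\lambda\neq0$, and $\hat k_\lambda=k_\lambda/\|k_\lambda\|$. $\mathbb{B}(\mathcal{H})$ is the algebra of bounded linear operators on $\mathcal{H}$. For $T\in\mathbb{B}(\mathcal{H})$, $\mathbf{ber}(T)=\sup_{\lambda\in\Omega}|\langle T\hat k_\lambda,\hat k_\lambda\rangle|$ (Berezin number), $\|T\|_{ber}=\sup_{\lambda,\mu\in\Omega}|\langle T\hat k_\lambda,\hat k_\mu\rangle|$ (Berezin norm), and $|T|=(T^*T)^{1/2}$. $\mathcal{H}\oplus\mathcal{H}$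 is treated as an RKHS on $\Omega^2$ whose kernel at $(\lambda_1,\lambda_2)$ is the vector $(k_{\lambda_1},k_{\lambda_2})$, with normalization $\hat k_{(\lambda_1,\lambda_2)}=(k_{\lambda_1},k_{\lambda_2})/(\|k_{\lambda_1}\|^2+\|k_{\lambda_2}\|^2)^{1/2}$; thus for an operator $A$ on $\mathcal{H}\oplus\mathcal{H}$, $\mathbf{ber}(A)=\sup_{(\lambda_1,\lambda_2)\in\Omega^2}|\langle A\hat k_{(\lambda_1,\lambda_2)},\hat k_{(\lambda_1,\lambda_2)}\rangle|$. *)

theory Defs
  imports "HOL-Analysis.Analysis"
begin

text \<open>The inner product is linear in the first argument. The complex structure extends the real
  one of the library classes, so that limits, completeness, \<^const>\<open>bounded_linear\<close> and the
  norm on products are the library notions.\<close>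

class complex_vector = real_vector +
  fixes scaleC :: "complex \<Rightarrow> 'a \<Rightarrow> 'a"  (infixr \<open>*\<^sub>C\<close> 75)
  assumes scaleC_add_right: "c *\<^sub>C (x + y) = c *\<^sub>C x + c *\<^sub>C y"
    and scaleC_add_left: "(c + d) *\<^sub>C x = c *\<^sub>C x + d *\<^sub>C x"
    and scaleC_scaleC: "c *\<^sub>C d *\<^sub>C x = (c * d) *\<^sub>C x"
    and scaleR_scaleC: "r *\<^sub>R x = complex_of_real r *\<^sub>C x"

class complex_inner = complex_vector + real_normed_vector +
  fixes cinner :: "'a \<Rightarrow> 'a \<Rightarrow> complex"
  assumes cinner_commute: "cinner x y = cnj (cinner y x)"
    and cinner_add_left: "cinner (x + y) z = cinner x z + cinner y z"
    and cinner_scaleC_left: "cinner (c *\<^sub>C x) y = c * cinner x y"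
    and cinner_ge_zero: "0 \<le> Re (cinner x x)"
    and cinner_eq_zero_iff: "cinner x x = 0 \<longleftrightarrow> x = 0"
    and norm_eq_sqrt_cinner: "norm x = sqrt (Re (cinner x x))"

class chilbert_space = complex_inner + complete_space

instantiation complex :: chilbert_space
begin
definition scaleC_complex :: "complex \<Rightarrow> complex \<Rightarrow> complex"
  where "scaleC_complex c x = c * x"
definition cinner_complex :: "complex \<Rightarrow> complex \<Rightarrow> complex"
  where "cinner_complex x y = x * cnj y"
instance
  by standard
    (auto simp: scaleC_complex_def cinner_complex_def algebra_simps scaleR_conv_of_real
      cmod_def power2_eq_square)
end

instantiation prod :: (complex_vector, complex_vector) complex_vector
begin
definition scaleC_prod :: "complex \<Rightarrow> 'a \<times> 'b \<Rightarrow> 'a \<times> 'b"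
  where "scaleC_prod c x = (c *\<^sub>C fst x, c *\<^sub>C snd x)"
instance
  by standard
    (auto simp: scaleC_prod_def prod_eq_iff scaleC_add_right scaleC_add_left scaleC_scaleC
      scaleR_scaleC)
end

lemma Im_cinner_self: "Im (cinner x x) = 0"
  using arg_cong[OF cinner_commute[of x x], of Im] by simp

instantiation prod :: (complex_inner, complex_inner) complex_inner
begin
definition cinner_prod :: "'a \<times> 'b \<Rightarrow> 'a \<times> 'b \<Rightarrow> complex"
  where "cinner_prod x y = cinner (fst x) (fst y) + cinner (snd x) (snd y)"
instance
proof
  fix x y z :: "'a \<times> 'b" and c :: complex
  show "cinner x y = cnj (cinner y x)"
    unfolding cinner_prod_def
    using cinner_commute[of "fst x" "fst y"] cinner_commute[of "snd x" "snd y"] by simp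
  show "cinner (x + y) z = cinner x z + cinner y z"
    by (simp add: cinner_prod_def cinner_add_left)
  show "cinner (c *\<^sub>C x) y = c * cinner x y"
    by (simp add: cinner_prod_def scaleC_prod_def cinner_scaleC_left distrib_left)
  show "0 \<le> Re (cinner x x)"
    by (simp add: cinner_prod_def cinner_ge_zero)
  have "cinner x x = 0 \<longleftrightarrow> cinner (fst x) (fst x) = 0 \<and> cinner (snd x) (snd x) = 0"
    using cinner_ge_zero[of "fst x"] cinner_ge_zero[of "snd x"]
    by (auto simp: cinner_prod_def complex_eq_iff Im_cinner_self)
  then show "cinner x x = 0 \<longleftrightarrow> x = 0"
    by (simp add: cinner_eq_zero_iff prod_eq_iff)
  show "norm x = sqrt (Re (cinner x x))"
    by (simp add: norm_prod_def cinner_prod_def norm_eq_sqrt_cinner cinner_ge_zero)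
qed
end

instance prod :: (chilbert_space, chilbert_space) chilbert_space ..

definition bounded_clinear :: "('a::complex_inner \<Rightarrow> 'b::complex_inner) \<Rightarrow> bool"
  where "bounded_clinear T \<longleftrightarrow> bounded_linear T \<and> (\<forall>c x. T (c *\<^sub>C x) = c *\<^sub>C T x)"

definition cadjoint :: "('a::chilbert_space \<Rightarrow> 'a) \<Rightarrow> 'a \<Rightarrow> 'a"
  where "cadjoint T =
    (THE S. bounded_clinear S \<and> (\<forall>x y. cinner (T x) y = cinner x (S y)))"

definition positive_op :: "('a::chilbert_space \<Rightarrow> 'a) \<Rightarrow> bool"
  where "positive_op T \<longleftrightarrow> bounded_clinear T \<and> (\<forall>x. cinner (T x) x \<in> \<real>\<^sub>\<ge>\<^sub>0)"

definition op_sqrt :: "('a::chilbert_space \<Rightarrow> 'a) \<Rightarrow> 'a \<Rightarrow> 'a"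
  where "op_sqrt P = (THE S. positive_op S \<and> S \<circ> S = P)"

definition op_abs :: "('a::chilbert_space \<Rightarrow> 'a) \<Rightarrow> 'a \<Rightarrow> 'a"
  where "op_abs T = op_sqrt (cadjoint T \<circ> T)"

text \<open>A space of functions on \<open>\<Omega>\<close> is a type \<open>'h\<close> whose elements \<open>f\<close> are identified with the
  functions \<open>ev f\<close> on \<open>\<Omega>\<close>; values of \<open>ev f\<close> outside \<open>\<Omega>\<close> are irrelevant.\<close>

definition rkernel :: "('h::chilbert_space \<Rightarrow> 'w \<Rightarrow> complex) \<Rightarrow> 'w \<Rightarrow> 'h"
  where "rkernel ev l = (THE k. \<forall>f. ev f l = cinner f k)"

locale rkhs =
  fixes \<Omega> :: "'w set" and ev :: "'h::chilbert_space \<Rightarrow> 'w \<Rightarrow> complex"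
  assumes nonempty: "\<Omega> \<noteq> {}"
    and ev_eqI: "(\<And>l. l \<in> \<Omega> \<Longrightarrow> ev f l = ev g l) \<Longrightarrow> f = g"
    and ev_bounded_clinear: "l \<in> \<Omega> \<Longrightarrow> bounded_clinear (\<lambda>f. ev f l)"
    and rkernel_nonzero: "l \<in> \<Omega> \<Longrightarrow> rkernel ev l \<noteq> 0"

text \<open>The Berezin number and norm depend on the index set \<open>X\<close> and on the family \<open>k\<close> of kernel
  vectors. For bounded operators the suprema are over nonempty bounded sets of reals.\<close>

definition normalized :: "'a::real_normed_vector \<Rightarrow> 'a"
  where "normalized v = v /\<^sub>R norm v"

definition ber :: "'x set \<Rightarrow> ('x \<Rightarrow> 'a::chilbert_space) \<Rightarrow> ('a \<Rightarrow> 'a) \<Rightarrow> real"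
  where "ber X k T = (SUP l\<in>X. cmod (cinner (T (normalized (k l))) (normalized (k l))))"

definition ber_norm :: "'x set \<Rightarrow> ('x \<Rightarrow> 'a::chilbert_space) \<Rightarrow> ('a \<Rightarrow> 'a) \<Rightarrow> real"
  where "ber_norm X k T =
    (SUP (l, m)\<in>X \<times> X. cmod (cinner (T (normalized (k l))) (normalized (k m))))"

definition sum_kernel :: "('w \<Rightarrow> 'h) \<Rightarrow> 'w \<times> 'w \<Rightarrow> 'h \<times> 'h"
  where "sum_kernel k = (\<lambda>(l1, l2). (k l1, k l2))"

definition block_op ::
  "('h::chilbert_space \<Rightarrow> 'h) \<Rightarrow> ('h \<Rightarrow> 'h) \<Rightarrow> ('h \<Rightarrow> 'h) \<Rightarrow> ('h \<Rightarrow> 'h) \<Rightarrow> 'h \<times> 'h \<Rightarrow> 'h \<times> 'h"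
  where "block_op A11 A12 A21 A22 = (\<lambda>(x, y). (A11 x + A12 y, A21 x + A22 y))"

end

theory Submission
  imports Defs
begin

text \<open>For unit vectors \<open>u\<close>, \<open>v\<close> in the directions of \<open>k l\<close>, \<open>k m\<close>, the quadratic form of the
  block operator at the normalised vector \<open>(a u, b v)\<close> with \<open>a\<^sup>2 + b\<^sup>2 = 1\<close> is at most
  \<open>a\<^sup>2 \<alpha> + b\<^sup>2 \<beta> + a b (|\<langle>A12 v, u\<rangle>| + |\<langle>A21 u, v\<rangle>|)\<close>. The mixed Schwarz inequality
  \<open>|\<langle>T x, y\<rangle>|\<^sup>2 \<le> \<langle>|T| x, x\<rangle> \<langle>|T\<^sup>*| y, y\<rangle>\<close> and the Cauchy-Schwarz inequality in the plane bound the bracket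
  by the square root of the product of the two Berezin norms; maximising over \<open>a\<close>, \<open>b\<close> gives the
  largest eigenvalue of a symmetric \<open>2 \<times> 2\<close> matrix. The mixed Schwarz inequality holds because
  \<open>S + B \<ge> 0\<close> whenever \<open>B\<close> is self-adjoint, \<open>S \<ge> 0\<close> and \<open>S\<^sup>2 = B\<^sup>2\<close>, applied to the operator \<open>B\<close>
  on the direct sum with off-diagonal entries \<open>T\<^sup>*\<close>, \<open>T\<close>.\<close>

subsection \<open>Complex inner products\<close>

lemma cinner_zero_left [simp]: "cinner 0 (y::'a::complex_inner) = 0"
  using cinner_add_left[of 0 0 y] by simp

lemma cinner_minus_left: "cinner (- x) y = - cinner x (y::'a::complex_inner)"
  using cinner_add_left[of x "- x" y] by (simp add: eq_neg_iff_add_eq_0 add.commute)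

lemma cinner_diff_left: "cinner (x - z) y = cinner x y - cinner z (y::'a::complex_inner)"
  using cinner_add_left[of x "- z" y] by (simp add: cinner_minus_left)

lemma cinner_scaleR_left: "cinner (r *\<^sub>R x) y = of_real r * cinner x (y::'a::complex_inner)"
  by (simp add: scaleR_scaleC cinner_scaleC_left)

lemma cinner_zero_right [simp]: "cinner (y::'a::complex_inner) 0 = 0"
  by (metis cinner_commute cinner_zero_left complex_cnj_zero)

lemma cinner_add_right: "cinner (y::'a::complex_inner) (x + z) = cinner y x + cinner y z"
  by (metis cinner_add_left cinner_commute complex_cnj_add)

lemma cinner_diff_right: "cinner (y::'a::complex_inner) (x - z) = cinner y x - cinner y z"
  by (metis cinner_diff_left cinner_commute complex_cnj_diff)

lemma cinner_scaleC_right: "cinner (y::'a::complex_inner) (c *\<^sub>C x) = cnj c * cinner y x"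
  by (metis cinner_scaleC_left cinner_commute complex_cnj_mult)

lemma cinner_scaleR_right: "cinner (y::'a::complex_inner) (r *\<^sub>R x) = of_real r * cinner y x"
  by (simp add: scaleR_scaleC cinner_scaleC_right)

lemmas cinner_simps = cinner_add_left cinner_diff_left cinner_scaleC_left cinner_scaleR_left
  cinner_add_right cinner_diff_right cinner_scaleC_right cinner_scaleR_right

lemma Re_cinner_self: "Re (cinner x x) = (norm (x::'a::complex_inner))\<^sup>2"
  by (simp add: norm_eq_sqrt_cinner cinner_ge_zero)

lemma cinner_self: "cinner x x = of_real ((norm (x::'a::complex_inner))\<^sup>2)"
  by (simp add: complex_eq_iff Re_cinner_self Im_cinner_self)

lemma norm_scaleC: "norm (c *\<^sub>C x) = cmod c * norm (x::'a::complex_inner)"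
proof -
  have "cinner (c *\<^sub>C x) (c *\<^sub>C x) = of_real ((cmod c)\<^sup>2 * (norm x)\<^sup>2)"
    by (simp only: cinner_scaleC_left cinner_scaleC_right of_real_mult complex_norm_square cinner_self[of x]
        mult_ac)
  then have "norm (c *\<^sub>C x) = sqrt ((cmod c * norm x)\<^sup>2)"
    by (simp add: norm_eq_sqrt_cinner[of "c *\<^sub>C x"] power_mult_distrib)
  then show ?thesis by simp
qed

lemma Re_cinner_commute: "Re (cinner x y) = Re (cinner y (x::'a::complex_inner))"
  by (metis cinner_commute complex_cnj(1) complex.sel(1) complex_surj)

lemma cinner_ext:
  assumes "\<And>x. cinner x y = cinner x (z::'a::complex_inner)"
  shows "y = z"
proof -
  have "cinner (y - z) (y - z) = 0"
    using assms[of "y - z"] by (simp add: cinner_diff_right)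
  then show ?thesis
    by (simp add: cinner_eq_zero_iff)
qed

section \<open>Bounded complex-linear maps\<close>

lemma bounded_clinearI:
  assumes "\<And>x y. T (x + y) = T x + T y" "\<And>c x. T (c *\<^sub>C x) = c *\<^sub>C T x"
    and "\<And>x. norm (T x) \<le> norm x * K"
  shows "bounded_clinear T"
  unfolding bounded_clinear_def
proof (intro conjI allI)
  show "bounded_linear T"
    using assms by (intro bounded_linear_intro[of T K]) (auto simp: scaleR_scaleC)
qed (rule assms(2))

lemma bounded_clinearD:
  assumes "bounded_clinear T"
  shows bounded_clinear_bounded_linear: "bounded_linear T"
    and bounded_clinear_add: "T (x + y) = T x + T y"
    and bounded_clinear_diff: "T (x - y) = T x - T y"
    and bounded_clinear_scaleC: "T (c *\<^sub>C x) = c *\<^sub>C T x"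
    and bounded_clinear_scaleR: "T (r *\<^sub>R x) = r *\<^sub>R T x"
    and bounded_clinear_zero: "T 0 = 0"
  using assms
  by (auto simp: bounded_clinear_def linear_simps bounded_linear.linear linear_0 linear_add
      linear_diff linear_cmul)

lemma scaleC_diff_right: "c *\<^sub>C (x - y) = c *\<^sub>C x - c *\<^sub>C (y::'a::complex_vector)"
  by (metis add_diff_cancel diff_add_cancel scaleC_add_right)

lemma scaleC_scaleR: "c *\<^sub>C r *\<^sub>R x = r *\<^sub>R c *\<^sub>C (x::'a::complex_vector)"
  by (simp add: scaleR_scaleC scaleC_scaleC mult.commute)

lemma bounded_clinear_id: "bounded_clinear (\<lambda>x. x)"
  by (simp add: bounded_clinear_def bounded_linear_ident)

lemma bounded_clinear_plus:
  "bounded_clinear S \<Longrightarrow> bounded_clinear T \<Longrightarrow> bounded_clinear (\<lambda>x. S x + T x)"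
  by (auto simp: bounded_clinear_def scaleC_add_right intro: bounded_linear_add)

lemma bounded_clinear_minus:
  "bounded_clinear S \<Longrightarrow> bounded_clinear T \<Longrightarrow> bounded_clinear (\<lambda>x. S x - T x)"
  by (auto simp: bounded_clinear_def scaleC_diff_right intro: bounded_linear_sub)

lemma bounded_clinear_const_scaleR:
  "bounded_clinear T \<Longrightarrow> bounded_clinear (\<lambda>x. r *\<^sub>R T x)"
  by (auto simp: bounded_clinear_def scaleC_scaleR
      intro: bounded_linear_compose[OF bounded_linear_scaleR_right])

lemma bounded_clinear_compose:
  "bounded_clinear S \<Longrightarrow> bounded_clinear T \<Longrightarrow> bounded_clinear (\<lambda>x. S (T x))"
  by (auto simp: bounded_clinear_def intro: bounded_linear_compose)

subsection \<open>Positive operators\<close>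

lemma positive_opI:
  assumes "bounded_clinear P" "\<And>x. 0 \<le> Re (cinner (P x) x)" "\<And>x. Im (cinner (P x) x) = 0"
  shows "positive_op P"
  using assms by (auto simp: positive_op_def complex_nonneg_Reals_iff)

lemma positive_op_bounded_clinear: "positive_op P \<Longrightarrow> bounded_clinear P"
  by (simp add: positive_op_def)

lemma positive_op_Re: "positive_op P \<Longrightarrow> 0 \<le> Re (cinner (P x) x)"
  by (simp add: positive_op_def complex_nonneg_Reals_iff)

lemma positive_op_Im: "positive_op P \<Longrightarrow> Im (cinner (P x) x) = 0"
  by (simp add: positive_op_def complex_nonneg_Reals_iff)

lemma positive_op_cinner: "positive_op P \<Longrightarrow> cinner (P x) x = of_real (Re (cinner (P x) x))"
  by (simp add: complex_eq_iff positive_op_Im)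

lemma positive_op_id: "positive_op (\<lambda>x. x)"
  by (intro positive_opI) (auto simp: bounded_clinear_id cinner_ge_zero Im_cinner_self)

text \<open>Polarisation: reality of the form at \<open>x + y\<close> makes the imaginary parts of
  \<open>cinner (P x) y\<close> and \<open>cinner (P y) x\<close> opposite, and reality at
  \<open>x + \<i> *\<^sub>C y\<close> makes their real parts equal.\<close>

lemma positive_op_hermitian:
  assumes "positive_op P"
  shows "cinner (P x) y = cinner x (P y)"
proof -
  note simps = cinner_simps bounded_clinearD[OF positive_op_bounded_clinear[OF assms]]
  have "Im (cinner (P x) y) + Im (cinner (P y) x) = 0"
    using positive_op_Im[OF assms, of "x + y"] positive_op_Im[OF assms, of x]
      positive_op_Im[OF assms, of y] by (simp add: simps)
  moreover have "Re (cinner (P x) y) = Re (cinner (P y) x)"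
    using positive_op_Im[OF assms, of "x + \<i> *\<^sub>C y"] positive_op_Im[OF assms, of x]
      positive_op_Im[OF assms, of y] by (simp add: simps)
  ultimately have "cinner (P x) y = cnj (cinner (P y) x)"
    by (simp add: complex_eq_iff)
  then show ?thesis
    by (metis cinner_commute)
qed

text \<open>A discriminant argument along the line \<open>x - t b y\<close>: the phase of
  \<open>b\<close> turns the cross terms into a real multiple of \<open>t\<close>. The form may
  degenerate, so \<open>d = 0\<close> is a separate case.\<close>

lemma positive_op_Cauchy_Schwarz:
  assumes "positive_op P"
  shows "(cmod (cinner (P x) y))\<^sup>2 \<le> Re (cinner (P x) x) * Re (cinner (P y) y)"
proof -
  note simps = cinner_simps bounded_clinearD[OF positive_op_bounded_clinear[OF assms]]
  define a b d where "a = Re (cinner (P x) x)" and "b = cinner (P x) y"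
    and "d = Re (cinner (P y) y)"
  have a: "cinner (P x) x = of_real a" and d: "cinner (P y) y = of_real d"
    using positive_op_cinner[OF assms] by (simp_all add: a_def d_def)
  have b': "cinner (P y) x = cnj b"
    unfolding b_def by (metis assms cinner_commute positive_op_hermitian)
  have quad: "0 \<le> a - 2 * t * (cmod b)\<^sup>2 + t\<^sup>2 * (cmod b)\<^sup>2 * d" for t :: real
  proof -
    define c where "c = of_real t * b"
    have "0 \<le> Re (cinner (P (x - c *\<^sub>C y)) (x - c *\<^sub>C y))"
      by (rule positive_op_Re[OF assms])
    also have "cinner (P (x - c *\<^sub>C y)) (x - c *\<^sub>C y) =
        of_real a - cnj c * b - c * cnj b + c * cnj c * of_real d"
      by (simp add: simps a d b' b_def[symmetric] algebra_simps)
    also have "Re \<dots> = a - 2 * t * (cmod b)\<^sup>2 + t\<^sup>2 * (cmod b)\<^sup>2 * d"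
      unfolding cmod_power2 by (simp add: c_def power2_eq_square algebra_simps)
    finally show ?thesis .
  qed
  have "0 \<le> d"
    unfolding d_def by (rule positive_op_Re[OF assms])
  have "(cmod b)\<^sup>2 \<le> a * d"
  proof (cases "d = 0")
    case False
    with \<open>0 \<le> d\<close> have "d > 0" by simp
    have "0 \<le> a - (cmod b)\<^sup>2 / d"
      using quad[of "1 / d"] \<open>d > 0\<close> by (simp add: power2_eq_square field_simps)
    then show ?thesis
      using \<open>d > 0\<close> by (simp add: field_simps)
  next
    case True
    have "b = 0"
    proof (rule ccontr)
      assume "b \<noteq> 0"
      then show False
        \<comment> \<open>For \<open>d = 0\<close> the bound \<open>quad\<close> is affine in
          \<open>t\<close>; this \<open>t\<close> gives it the value -1.\<close>
        using quad[of "(a + 1) / (2 * (cmod b)\<^sup>2)"] True by simp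
    qed
    then show ?thesis by (simp add: True)
  qed
  then show ?thesis by (simp add: a_def b_def d_def)
qed

text \<open>Cauchy-Schwarz for the form of \<open>P\<close>, tested against \<open>P x\<close>
  itself.\<close>

lemma positive_op_eq_zero:
  assumes "positive_op P" "Re (cinner (P x) x) = 0"
  shows "P x = 0"
  using positive_op_Cauchy_Schwarz[OF assms(1), of x "P x"] assms(2)
  by (simp add: cinner_eq_zero_iff)

lemma cinner_Cauchy_Schwarz: "cmod (cinner x y) \<le> norm x * norm (y::'a::chilbert_space)"
proof (rule power2_le_imp_le)
  show "(cmod (cinner x y))\<^sup>2 \<le> (norm x * norm y)\<^sup>2"
    using positive_op_Cauchy_Schwarz[OF positive_op_id, of x y]
    by (simp add: Re_cinner_self power_mult_distrib)
qed simp

lemma tendsto_cinner_left: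
  "(f \<longlongrightarrow> (a::'a::chilbert_space)) F \<Longrightarrow> ((\<lambda>n. cinner (f n) y) \<longlongrightarrow> cinner a y) F"
  by (rule bounded_linear.tendsto[OF bounded_linear_intro[of _ "norm y"]])
    (auto simp: cinner_simps cinner_Cauchy_Schwarz scaleR_conv_of_real)

lemma tendsto_cinner_right:
  assumes "(f \<longlongrightarrow> (a::'a::chilbert_space)) F"
  shows "((\<lambda>n. cinner y (f n)) \<longlongrightarrow> cinner y a) F"
proof -
  have "((\<lambda>n. cnj (cinner (f n) y)) \<longlongrightarrow> cnj (cinner a y)) F"
    by (intro tendsto_intros tendsto_cinner_left assms)
  then show ?thesis
    by (simp flip: cinner_commute)
qed

subsection \<open>Riesz representation and adjoints\<close>

text \<open>The representing vector minimises \<open>norm x ^ 2 - 2 * Re (f x)\<close>, a strongly convex function.\<close>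

lemma Riesz_representation:
  fixes f :: "'a::chilbert_space \<Rightarrow> complex"
  assumes f: "bounded_clinear f"
  shows "\<exists>u. \<forall>x. f x = cinner x u"
proof -
  define \<phi> where "\<phi> x = (norm x)\<^sup>2 - 2 * Re (f x)" for x
  note lin = bounded_clinearD[OF f]
  obtain K where K: "\<And>x. cmod (f x) \<le> norm x * K"
    using bounded_linear.bounded[OF lin(1)] by blast
  have lower: "- K\<^sup>2 \<le> \<phi> x" for x
  proof -
    have "Re (f x) \<le> norm x * K"
      using K[of x] complex_Re_le_cmod[of "f x"] by linarith
    then have "(norm x)\<^sup>2 - 2 * (norm x * K) \<le> \<phi> x"
      by (simp add: \<phi>_def)
    moreover have "0 \<le> (norm x - K)\<^sup>2" by simp
    ultimately show ?thesis
      by (simp add: power2_diff)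
  qed
  define m where "m = Inf (range \<phi>)"
  have bdd: "bdd_below (range \<phi>)"
    using lower by (intro bdd_belowI[of _ "- K\<^sup>2"]) auto
  have m_le: "m \<le> \<phi> x" for x
    unfolding m_def by (intro cInf_lower bdd) auto
  have "\<exists>x. \<phi> x < m + inverse (of_nat (Suc n))" for n
    using cInf_less_iff[OF _ bdd, of "m + inverse (of_nat (Suc n))"]
    unfolding m_def by auto
  then obtain X where X: "\<And>n. \<phi> (X n) < m + inverse (of_nat (Suc n))"
    by metis
  \<comment> \<open>The parallelogram law with the midpoint of \<open>x\<close> and
    \<open>y\<close>; the linear parts of \<phi> cancel. Hence a minimising sequence is
    Cauchy.\<close>
  have par: "(norm (x - y))\<^sup>2 \<le> 2 * (\<phi> x - m) + 2 * (\<phi> y - m)" for x y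
  proof -
    have "(norm (x - y))\<^sup>2 = 2 * \<phi> x + 2 * \<phi> y - 4 * \<phi> ((1/2) *\<^sub>R (x + y))"
      unfolding \<phi>_def lin Re_cinner_self[symmetric]
      by (simp add: cinner_simps Re_cinner_commute[of y x] algebra_simps)
    then show ?thesis
      using m_le[of "(1/2) *\<^sub>R (x + y)"] by simp
  qed
  have "Cauchy X"
  proof (rule metric_CauchyI)
    fix e :: real assume "0 < e"
    then obtain N where N: "inverse (of_nat (Suc N)) < e\<^sup>2 / 4"
      using reals_Archimedean[of "e\<^sup>2 / 4"] by auto
    have small: "\<phi> (X n) - m < e\<^sup>2 / 4" if "n \<ge> N" for n
    proof -
      have "inverse (of_nat (Suc n)) \<le> (inverse (of_nat (Suc N)) :: real)"
        using that by (simp add: field_simps)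
      then show ?thesis using X[of n] N by linarith
    qed
    have "dist (X p) (X q) < e" if "p \<ge> N" "q \<ge> N" for p q
    proof -
      have "(norm (X p - X q))\<^sup>2 < e\<^sup>2"
        using par[of "X p" "X q"] small[OF that(1)] small[OF that(2)] by argo
      then show ?thesis
        using \<open>0 < e\<close> by (auto simp: dist_norm intro: power2_less_imp_less)
    qed
    then show "\<exists>N. \<forall>p\<ge>N. \<forall>q\<ge>N. dist (X p) (X q) < e"
      by blast
  qed
  then obtain u where u: "X \<longlonglongrightarrow> u"
    using Cauchy_convergent convergent_def by blast
  have "(\<lambda>n. \<phi> (X n)) \<longlonglongrightarrow> \<phi> u"
    unfolding \<phi>_def by (intro tendsto_intros u bounded_linear.tendsto[OF lin(1)])
  moreover have "(\<lambda>n. m + inverse (of_nat (Suc n))) \<longlonglongrightarrow> m + 0"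
    by (intro tendsto_intros LIMSEQ_inverse_real_of_nat)
  ultimately have "\<phi> u \<le> m + 0"
    by (rule LIMSEQ_le) (use X in \<open>auto intro: less_imp_le\<close>)
  then have min: "\<phi> u \<le> \<phi> x" for x
    using m_le[of x] by simp
  have Re: "Re (f v) = Re (cinner v u)" for v
  proof (rule ccontr)
    define D where "D = Re (cinner v u) - Re (f v)"
    assume "Re (f v) \<noteq> Re (cinner v u)"
    then have "D \<noteq> 0" by (simp add: D_def)
    have quad: "0 \<le> t\<^sup>2 * (norm v)\<^sup>2 + 2 * t * D" for t
    proof -
      have "\<phi> (u + t *\<^sub>R v) = \<phi> u + t\<^sup>2 * (norm v)\<^sup>2 + 2 * t * D"
        unfolding \<phi>_def lin Re_cinner_self[symmetric] D_def
        by (simp add: lin cinner_simps Re_cinner_commute[of u v] algebra_simps power2_eq_square)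
      then show ?thesis using min[of "u + t *\<^sub>R v"] by simp
    qed
    have "0 < 1 + (norm v)\<^sup>2"
      by (simp add: add_pos_nonneg)
    \<comment> \<open>The minimiser in \<open>t\<close> would be
      \<open>- D / (norm v)\<^sup>2\<close>; adding 1 to the denominator also covers
      \<open>v = 0\<close> and still makes the quadratic negative.\<close>
    then have "0 \<le> D\<^sup>2 * ((norm v)\<^sup>2 / (1 + (norm v)\<^sup>2)\<^sup>2 - 2 / (1 + (norm v)\<^sup>2))"
      using quad[of "- D / (1 + (norm v)\<^sup>2)"]
      by (simp add: power_divide algebra_simps power2_eq_square)
    moreover have "(norm v)\<^sup>2 / (1 + (norm v)\<^sup>2)\<^sup>2 - 2 / (1 + (norm v)\<^sup>2) < 0"
      using \<open>0 < 1 + (norm v)\<^sup>2\<close>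
      by (simp add: field_simps power2_eq_square add_pos_nonneg)
    ultimately show False
      using \<open>D \<noteq> 0\<close> by (simp add: zero_le_mult_iff)
  qed
  \<comment> \<open>The real part at \<open>\<i> *\<^sub>C v\<close> is minus the imaginary part at
    \<open>v\<close>.\<close>
  have "f v = cinner v u" for v
    using Re[of v] Re[of "\<i> *\<^sub>C v"]
    by (simp add: complex_eq_iff lin cinner_simps scaleC_complex_def)
  then show ?thesis by blast
qed

lemma cinner_bounded_clinear:
  assumes "bounded_clinear T"
  shows "bounded_clinear (\<lambda>x. cinner (T x) (y::'a::chilbert_space))"
proof -
  note lin = bounded_clinearD[OF assms]
  obtain K where K: "\<And>x. norm (T x) \<le> norm x * K"
    using bounded_linear.bounded[OF lin(1)] by blast
  show ?thesis
  proof (rule bounded_clinearI)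
    show "cmod (cinner (T x) y) \<le> norm x * (K * norm y)" for x
      using cinner_Cauchy_Schwarz[of "T x" y] mult_right_mono[OF K[of x] norm_ge_zero[of y]]
      by (simp add: mult.assoc)
  qed (simp_all add: lin cinner_simps scaleC_complex_def)
qed

text \<open>Riesz gives \<open>S y\<close> for each \<open>y\<close> separately. Linearity comes
  from testing against all vectors; the bound comes from
  \<open>(norm (S y))\<^sup>2 = cinner (T (S y)) y\<close> after cancelling one factor.\<close>

lemma adjoint_exists:
  fixes T :: "'a::chilbert_space \<Rightarrow> 'a"
  assumes "bounded_clinear T"
  shows "\<exists>S. bounded_clinear S \<and> (\<forall>x y. cinner (T x) y = cinner x (S y))"
proof -
  obtain S where S: "\<And>x y. cinner (T x) y = cinner x (S y)"
    using Riesz_representation[OF cinner_bounded_clinear[OF assms]] by metis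
  obtain K where K: "\<And>x. norm (T x) \<le> norm x * K" and "0 \<le> K"
    using bounded_linear.nonneg_bounded[OF bounded_clinearD(1)[OF assms]] by blast
  have "bounded_clinear S"
  proof (rule bounded_clinearI)
    show "norm (S y) \<le> norm y * K" for y
    proof -
      have "(norm (S y))\<^sup>2 = cmod (cinner (T (S y)) y)"
        by (simp add: S cinner_self norm_power)
      also have "\<dots> \<le> norm (S y) * (norm y * K)"
        using order_trans[OF cinner_Cauchy_Schwarz[of "T (S y)" y]
            mult_right_mono[OF K[of "S y"] norm_ge_zero[of y]]]
        by (simp add: mult_ac)
      finally show ?thesis
        using \<open>0 \<le> K\<close> by (cases "norm (S y) = 0") (auto simp: power2_eq_square)
    qed
  qed (rule cinner_ext, simp add: cinner_simps flip: S)+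
  then show ?thesis using S by blast
qed

lemma cadjoint_eqI:
  assumes "bounded_clinear S" "\<And>x y. cinner (T x) y = cinner x (S y)"
  shows "cadjoint T = S"
  unfolding cadjoint_def
proof (rule the_equality)
  show "S' = S" if S': "bounded_clinear S' \<and> (\<forall>x y. cinner (T x) y = cinner x (S' y))" for S'
  proof
    show "S' y = S y" for y
    proof (rule cinner_ext)
      show "cinner x (S' y) = cinner x (S y)" for x
        using S' assms(2)[of x y] by simp
    qed
  qed
qed (use assms in blast)

lemma cadjoint:
  assumes "bounded_clinear T"
  shows bounded_clinear_cadjoint: "bounded_clinear (cadjoint T)"
    and cinner_cadjoint_right: "cinner (T x) y = cinner x (cadjoint T y)"
proof -
  obtain S where S: "bounded_clinear S" "\<And>x y. cinner (T x) y = cinner x (S y)"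
    using adjoint_exists[OF assms] by blast
  then have "cadjoint T = S"
    by (rule cadjoint_eqI)
  with S show "bounded_clinear (cadjoint T)" "cinner (T x) y = cinner x (cadjoint T y)"
    by simp_all
qed

lemma cinner_cadjoint_left:
  "bounded_clinear T \<Longrightarrow> cinner (cadjoint T x) y = cinner x (T y)"
  by (metis cinner_cadjoint_right cinner_commute)

lemma cadjoint_cadjoint: "bounded_clinear T \<Longrightarrow> cadjoint (cadjoint T) = T"
  by (intro cadjoint_eqI) (auto simp: cinner_cadjoint_left)

subsection \<open>Square roots of positive operators\<close>

text \<open>If \<open>0 \<le> R \<le> 1\<close>, the iterates converge to \<open>Y\<close> with \<open>2 Y = R + Y\<^sup>2\<close>, so that
  \<open>(1 - Y)\<^sup>2 = 1 - R\<close>. They are dominated by the scalar iterates for \<open>R = 1\<close>.\<close>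

fun sqrt_iter :: "('a::real_vector \<Rightarrow> 'a) \<Rightarrow> nat \<Rightarrow> 'a \<Rightarrow> 'a" where
  "sqrt_iter R 0 x = 0"
| "sqrt_iter R (Suc n) x = (1/2) *\<^sub>R (R x + sqrt_iter R n (sqrt_iter R n x))"

fun sqrt_bound :: "nat \<Rightarrow> real" where
  "sqrt_bound 0 = 0"
| "sqrt_bound (Suc n) = (1 + sqrt_bound n * sqrt_bound n) / 2"

lemma sqrt_bound_range: "0 \<le> sqrt_bound n \<and> sqrt_bound n \<le> 1"
proof (induction n)
  case (Suc n)
  then have "sqrt_bound n * sqrt_bound n \<le> 1 * 1"
    by (intro mult_mono) auto
  then show ?case using Suc by simp
qed simp

text \<open>The increment is half the square of \<open>1 - sqrt_bound n\<close>.\<close>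

lemma sqrt_bound_mono: "sqrt_bound n \<le> sqrt_bound (Suc n)"
proof -
  have "0 \<le> (1 - sqrt_bound n)\<^sup>2" by simp
  then show ?thesis by (simp add: power2_eq_square algebra_simps)
qed

lemma Cauchy_sqrt_bound: "Cauchy sqrt_bound"
proof -
  have "convergent sqrt_bound"
    using sqrt_bound_range sqrt_bound_mono
    by (intro Bseq_monoseq_convergent) (auto intro!: BseqI'[of _ 1] monoI1 simp: monoseq_Suc)
  then show ?thesis by (rule convergent_Cauchy)
qed

lemma bounded_clinear_sqrt_iter: "bounded_clinear R \<Longrightarrow> bounded_clinear (sqrt_iter R n)"
proof (induction n)
  case 0
  show ?case
    by (rule bounded_clinearI[of _ 0]) (auto simp: scaleC_scaleR[of _ 0 0, simplified])
next
  case (Suc n)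
  then show ?case
    by (simp add: bounded_clinear_const_scaleR bounded_clinear_plus bounded_clinear_compose)
qed

text \<open>The iterates are polynomials in \<open>R\<close>. The property survives the limit, and
  uniqueness of square roots rests on it.\<close>

lemma sqrt_iter_commute:
  assumes "bounded_clinear T" "\<And>x. T (R x) = R (T x)"
  shows "T (sqrt_iter R n x) = sqrt_iter R n (T x)"
  by (induction n arbitrary: x) (simp_all add: bounded_clinearD[OF assms(1)] assms(2))

lemma sqrt_iter_hermitian:
  assumes "\<And>x y. cinner (R x) y = cinner x (R y)"
  shows "cinner (sqrt_iter R n x) y = cinner x (sqrt_iter R n y)"
  by (induction n arbitrary: x y) (simp_all add: cinner_simps assms)

text \<open>Both bounds go through one induction, since the norm bound at \<open>Suc n\<close>
  follows from the two at \<open>n\<close>. The increment is controlled by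
  \<open>U\<^sup>2 - V\<^sup>2 = U (U - V) + (U - V) V\<close> for consecutive iterates; the same
  identity for the scalars gives exactly the next scalar increment.\<close>

lemma sqrt_iter_bounds:
  assumes R: "bounded_clinear R" "\<And>x. norm (R x) \<le> norm x"
  shows "norm (sqrt_iter R n x) \<le> sqrt_bound n * norm x \<and>
    norm (sqrt_iter R (Suc n) x - sqrt_iter R n x) \<le> (sqrt_bound (Suc n) - sqrt_bound n) * norm x"
proof (induction n arbitrary: x)
  case 0
  show ?case using R(2)[of x] by simp
next
  case (Suc n)
  let ?Y = "sqrt_iter R" and ?s = "sqrt_bound"
  note lin = bounded_clinearD[OF bounded_clinear_sqrt_iter[OF R(1)]]
  have Y: "norm (?Y n x) \<le> ?s n * norm x" for x
    using Suc.IH[of x] by simp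
  have d: "norm (?Y (Suc n) x - ?Y n x) \<le> (?s (Suc n) - ?s n) * norm x" for x
    using Suc.IH[of x] by simp
  have Y': "norm (?Y (Suc n) x) \<le> ?s (Suc n) * norm x" for x
    using norm_triangle_ineq[of "?Y (Suc n) x - ?Y n x" "?Y n x"] Y[of x] d[of x]
    by (simp add: algebra_simps)
  have "?Y (Suc (Suc n)) x - ?Y (Suc n) x =
    (1/2) *\<^sub>R (?Y (Suc n) (?Y (Suc n) x - ?Y n x) + (?Y (Suc n) (?Y n x) - ?Y n (?Y n x)))"
    unfolding lin(3) sqrt_iter.simps(2)[of R "Suc n" x] sqrt_iter.simps(2)[of R n x]
    by (simp add: algebra_simps)
  moreover have "norm (?Y (Suc n) (?Y (Suc n) x - ?Y n x)) \<le>
      ?s (Suc n) * ((?s (Suc n) - ?s n) * norm x)"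
    using Y'[of "?Y (Suc n) x - ?Y n x"]
      mult_left_mono[OF d[of x], of "?s (Suc n)"] sqrt_bound_range[of "Suc n"] by linarith
  moreover have "norm (?Y (Suc n) (?Y n x) - ?Y n (?Y n x)) \<le>
      (?s (Suc n) - ?s n) * (?s n * norm x)"
    using d[of "?Y n x"] mult_left_mono[OF Y[of x], of "?s (Suc n) - ?s n"]
      sqrt_bound_mono[of n] by linarith
  ultimately have "norm (?Y (Suc (Suc n)) x - ?Y (Suc n) x) \<le>
     (?s (Suc n) * ((?s (Suc n) - ?s n) * norm x) + (?s (Suc n) - ?s n) * (?s n * norm x)) / 2"
    using norm_triangle_ineq[of "?Y (Suc n) (?Y (Suc n) x - ?Y n x)"
        "?Y (Suc n) (?Y n x) - ?Y n (?Y n x)"] by simp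
  also have "\<dots> = (?s (Suc (Suc n)) - ?s (Suc n)) * norm x"
    unfolding sqrt_bound.simps(2)[of "Suc n"] sqrt_bound.simps(2)[of n]
    by (simp add: field_simps)
  finally show ?case using Y' by blast
qed

lemma sqrt_iter_diff_le:
  assumes R: "bounded_clinear R" "\<And>x. norm (R x) \<le> norm x" and "n \<le> m"
  shows "norm (sqrt_iter R m x - sqrt_iter R n x) \<le> (sqrt_bound m - sqrt_bound n) * norm x"
  using \<open>n \<le> m\<close>
proof (induction m rule: dec_induct)
  case (step m)
  then show ?case
    using sqrt_iter_bounds[OF R, of m x]
      norm_triangle_ineq[of "sqrt_iter R (Suc m) x - sqrt_iter R m x"
        "sqrt_iter R m x - sqrt_iter R n x"]
    by (simp del: sqrt_iter.simps sqrt_bound.simps add: algebra_simps)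
qed simp

lemma sqrt_iter_convergent:
  fixes R :: "'a::chilbert_space \<Rightarrow> 'a"
  assumes R: "bounded_clinear R" "\<And>x. norm (R x) \<le> norm x"
  shows "convergent (\<lambda>n. sqrt_iter R n x)"
proof (intro Cauchy_convergent CauchyI)
  have dist: "norm (sqrt_iter R m x - sqrt_iter R n x) \<le> \<bar>sqrt_bound m - sqrt_bound n\<bar> * norm x"
    for m n
  proof (induction m n rule: linorder_wlog)
    case (le m n)
    show ?case
      using sqrt_iter_diff_le[OF R le, of x]
        mult_right_mono[OF abs_ge_self norm_ge_zero, of "sqrt_bound n - sqrt_bound m" x]
      by (simp add: norm_minus_commute abs_minus_commute)
  qed (simp add: norm_minus_commute abs_minus_commute)
  fix e :: real assume "0 < e"
  then have "0 < e / (1 + norm x)"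
    \<comment> \<open>The denominator \<open>1 + norm x\<close> avoids division by zero at
      \<open>x = 0\<close>.\<close>
    by (simp add: add_pos_nonneg)
  then obtain M where M: "\<And>m n. m \<ge> M \<Longrightarrow> n \<ge> M \<Longrightarrow> \<bar>sqrt_bound m - sqrt_bound n\<bar> < e / (1 + norm x)"
    using CauchyD[OF Cauchy_sqrt_bound] by (metis real_norm_def)
  have "norm (sqrt_iter R m x - sqrt_iter R n x) < e" if "m \<ge> M" "n \<ge> M" for m n
  proof -
    have "\<bar>sqrt_bound m - sqrt_bound n\<bar> * norm x \<le> e / (1 + norm x) * norm x"
      using M[OF that] by (intro mult_right_mono) auto
    also have "\<dots> < e"
      using \<open>0 < e\<close> by (simp add: field_simps add_pos_nonneg)
    finally show ?thesis using dist[of m n] by linarith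
  qed
  then show "\<exists>M. \<forall>m\<ge>M. \<forall>n\<ge>M. norm (sqrt_iter R m x - sqrt_iter R n x) < e"
    by blast
qed

text \<open>Cauchy-Schwarz for the form of \<open>R\<close> at \<open>x\<close> and
  \<open>R x\<close> bounds the fourth power of \<open>norm (R x)\<close> by
  \<open>(norm x)\<^sup>2 * (norm (R x))\<^sup>2\<close>.\<close>

lemma positive_contraction:
  assumes R: "positive_op R" and le: "\<And>x. Re (cinner (R x) x) \<le> (norm x)\<^sup>2"
  shows "norm (R x) \<le> norm x"
proof (rule power2_le_imp_le)
  have "((norm (R x))\<^sup>2)\<^sup>2 = (cmod (cinner (R x) (R x)))\<^sup>2"
    by (simp add: cinner_self norm_power)
  also have "\<dots> \<le> (norm x)\<^sup>2 * (norm (R x))\<^sup>2"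
    using positive_op_Cauchy_Schwarz[OF R, of x "R x"]
      mult_mono[OF le[of x] le[of "R x"] _ positive_op_Re[OF R]] by simp
  finally have "(norm (R x))\<^sup>2 * (norm (R x))\<^sup>2 \<le> (norm x)\<^sup>2 * (norm (R x))\<^sup>2"
    by (simp only: power2_eq_square[of "(norm (R x))\<^sup>2"])
  then show "(norm (R x))\<^sup>2 \<le> (norm x)\<^sup>2"
    by (cases "R x = 0") (simp_all only: mult_le_cancel_right, simp_all)
qed simp

lemma sqrt_limit:
  fixes R :: "'a::chilbert_space \<Rightarrow> 'a"
  assumes R: "positive_op R" and le: "\<And>x. Re (cinner (R x) x) \<le> (norm x)\<^sup>2"
  obtains Y where "positive_op (\<lambda>x. x - Y x)" "bounded_clinear Y"
    "\<And>x. Y (Y x) = 2 *\<^sub>R Y x - R x"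
    "\<And>T x. bounded_clinear T \<Longrightarrow> (\<And>x. T (R x) = R (T x)) \<Longrightarrow> T (Y x) = Y (T x)"
proof -
  note bR = positive_op_bounded_clinear[OF R]
  note conv = sqrt_iter_convergent[OF bR positive_contraction[OF R le]]
  note bnd = sqrt_iter_bounds[OF bR positive_contraction[OF R le], THEN conjunct1]
  note lin = bounded_clinearD[OF bounded_clinear_sqrt_iter[OF bR]]
  define Y where "Y x = lim (\<lambda>n. sqrt_iter R n x)" for x
  have Y: "(\<lambda>n. sqrt_iter R n x) \<longlonglongrightarrow> Y x" for x
    unfolding Y_def using conv by (simp add: convergent_LIMSEQ_iff)
  have iter_le: "norm (sqrt_iter R n x) \<le> norm x" for n x
    using bnd[of n x] mult_right_mono[of "sqrt_bound n" 1 "norm x"] sqrt_bound_range[of n]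
    by simp
  have Y_le: "norm (Y x) \<le> norm x" for x
    by (rule LIMSEQ_le_const2[OF tendsto_norm[OF Y]]) (use iter_le in blast)
  have commute: "T (Y x) = Y (T x)"
    if T: "bounded_clinear T" "\<And>x. T (R x) = R (T x)" for T x
  proof (rule LIMSEQ_unique)
    show "(\<lambda>n. T (sqrt_iter R n x)) \<longlonglongrightarrow> T (Y x)"
      by (rule bounded_linear.tendsto[OF bounded_clinearD(1)[OF T(1)] Y])
    show "(\<lambda>n. T (sqrt_iter R n x)) \<longlonglongrightarrow> Y (T x)"
      by (subst sqrt_iter_commute[where R = R]) (use T Y in auto)
  qed
  have add: "Y (x + y) = Y x + Y y" for x y
    using tendsto_add[OF Y Y, of x y] Y[of "x + y"] LIMSEQ_unique by (simp add: lin(2)) blast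
  have bY: "bounded_clinear Y"
  proof (rule bounded_clinearI[where K = 1, OF add])
    fix c x
    have "bounded_linear (\<lambda>x::'a. c *\<^sub>C x)"
      by (rule bounded_linear_intro[of _ "cmod c"])
        (simp_all add: scaleC_add_right scaleC_scaleR norm_scaleC)
    from bounded_linear.tendsto[OF this Y] have "(\<lambda>n. sqrt_iter R n (c *\<^sub>C x)) \<longlonglongrightarrow> c *\<^sub>C Y x"
      by (simp add: lin(4))
    then show "Y (c *\<^sub>C x) = c *\<^sub>C Y x"
      using Y LIMSEQ_unique by blast
  qed (use Y_le in simp)
  have square: "Y (Y x) = 2 *\<^sub>R Y x - R x" for x
  proof -
    \<comment> \<open>Convergence is only pointwise, so passing to the limit in the square needs the
      uniform bound \<open>iter_le\<close>: it removes the error made by replacing the inner iterate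
      with \<open>Y x\<close>.\<close>
    have "(\<lambda>n. sqrt_iter R n (sqrt_iter R n x - Y x)) \<longlonglongrightarrow> 0"
    proof (rule Lim_null_comparison)
      show "(\<lambda>n. norm (sqrt_iter R n x - Y x)) \<longlonglongrightarrow> 0"
        using Y by (intro tendsto_norm_zero LIM_zero)
    qed (use iter_le in \<open>auto intro!: always_eventually\<close>)
    from tendsto_add[OF this Y, of "Y x"]
    have "(\<lambda>n. sqrt_iter R n (sqrt_iter R n x)) \<longlonglongrightarrow> Y (Y x)"
      by (simp add: lin(3))
    then have "(\<lambda>n. (1/2) *\<^sub>R (R x + sqrt_iter R n (sqrt_iter R n x))) \<longlonglongrightarrow>
        (1/2) *\<^sub>R (R x + Y (Y x))"
      by (intro tendsto_intros)
    then have "Y x = (1/2) *\<^sub>R (R x + Y (Y x))"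
      using LIMSEQ_unique[OF LIMSEQ_Suc[OF Y[of x]]] unfolding sqrt_iter.simps by blast
    then have "2 *\<^sub>R Y x = 2 *\<^sub>R (1/2) *\<^sub>R (R x + Y (Y x))"
      by (rule arg_cong)
    then show ?thesis by simp
  qed
  have herm: "cinner (Y x) y = cinner x (Y y)" for x y
    using tendsto_cinner_left[OF Y, of x y] tendsto_cinner_right[OF Y, of x y]
    unfolding sqrt_iter_hermitian[of R, OF positive_op_hermitian[OF R]]
    by (rule LIMSEQ_unique)
  have pos: "positive_op (\<lambda>x. x - Y x)"
  proof (rule positive_opI)
    show "bounded_clinear (\<lambda>x. x - Y x)"
      by (intro bounded_clinear_minus bounded_clinear_id bY)
    fix x
    have "Re (cinner (Y x) x) \<le> (norm x)\<^sup>2"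
      using complex_Re_le_cmod[of "cinner (Y x) x"] cinner_Cauchy_Schwarz[of "Y x" x]
        mult_right_mono[OF Y_le norm_ge_zero, of x x] by (simp add: power2_eq_square)
    then show "0 \<le> Re (cinner (x - Y x) x)"
      by (simp add: cinner_simps Re_cinner_self)
    have "cinner (Y x) x = cnj (cinner (Y x) x)"
      by (metis herm cinner_commute)
    then have "Im (cinner (Y x) x) = 0"
      by (simp add: complex_eq_iff)
    then show "Im (cinner (x - Y x) x) = 0"
      by (simp add: cinner_simps Im_cinner_self)
  qed
  show thesis
    by (rule that[OF pos bY square commute])
qed

lemma positive_op_scaleR: "positive_op P \<Longrightarrow> 0 \<le> r \<Longrightarrow> positive_op (\<lambda>x. r *\<^sub>R P x)"
  by (intro positive_opI)
    (auto simp: cinner_simps bounded_clinear_const_scaleR positive_op_bounded_clinear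
      positive_op_Re positive_op_Im)

text \<open>Rescaling by a bound \<open>C\<close> for \<open>P\<close> puts
  \<open>R = 1 - P / C\<close> between 0 and 1; then
  \<open>P = C (1 - R) = C (1 - Y)\<^sup>2\<close>.\<close>

lemma positive_sqrt_exists:
  fixes P :: "'a::chilbert_space \<Rightarrow> 'a"
  assumes P: "positive_op P"
  obtains S where "positive_op S" "\<And>x. S (S x) = P x"
    "\<And>T x. bounded_clinear T \<Longrightarrow> (\<And>x. T (P x) = P (T x)) \<Longrightarrow> T (S x) = S (T x)"
proof -
  note bP = positive_op_bounded_clinear[OF P]
  obtain C where C: "C > 0" "\<And>x. norm (P x) \<le> norm x * C"
    using bounded_linear.pos_bounded[OF bounded_clinearD(1)[OF bP]] by blast
  define R where "R x = x - inverse C *\<^sub>R P x" for x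
  have Re_R: "Re (cinner (R x) x) = (norm x)\<^sup>2 - inverse C * Re (cinner (P x) x)" for x
    by (simp only: R_def cinner_simps Re_cinner_self minus_complex.simps Re_complex_of_real
        times_complex.simps Im_complex_of_real mult_zero_left diff_zero)
  have "positive_op R"
  proof (rule positive_opI)
    show "bounded_clinear R"
      unfolding R_def
      by (intro bounded_clinear_minus bounded_clinear_id bounded_clinear_const_scaleR bP)
    fix x
    have "Re (cinner (P x) x) \<le> C * (norm x)\<^sup>2"
      using complex_Re_le_cmod[of "cinner (P x) x"] cinner_Cauchy_Schwarz[of "P x" x]
        mult_right_mono[OF C(2) norm_ge_zero, of x x] by (simp add: power2_eq_square mult_ac)
    then show "0 \<le> Re (cinner (R x) x)"
      using C(1) by (simp add: Re_R field_simps)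
    show "Im (cinner (R x) x) = 0"
      by (simp add: R_def cinner_simps Im_cinner_self positive_op_Im[OF P])
  qed
  moreover have "Re (cinner (R x) x) \<le> (norm x)\<^sup>2" for x
    using C(1) positive_op_Re[OF P] by (simp add: Re_R)
  ultimately obtain Y where Y: "positive_op (\<lambda>x. x - Y x)" "bounded_clinear Y"
    "\<And>x. Y (Y x) = 2 *\<^sub>R Y x - R x"
    "\<And>T x. bounded_clinear T \<Longrightarrow> (\<And>x. T (R x) = R (T x)) \<Longrightarrow> T (Y x) = Y (T x)"
    using sqrt_limit by blast
  define S where "S x = sqrt C *\<^sub>R (x - Y x)" for x
  note linY = bounded_clinearD[OF Y(2)]
  show thesis
  proof (rule that[of S])
    show "positive_op S"
      unfolding S_def using C(1) by (intro positive_op_scaleR Y(1)) auto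
    show "S (S x) = P x" for x
    proof -
      have "S (S x) = C *\<^sub>R (x - Y x - (Y x - Y (Y x)))"
        using C(1) by (simp add: S_def linY flip: scaleR_diff_right)
      also have "\<dots> = C *\<^sub>R (x - R x)"
        by (simp add: Y(3) scaleR_2)
      also have "\<dots> = P x"
        using C(1) by (simp add: R_def)
      finally show ?thesis .
    qed
    show "T (S x) = S (T x)" if T: "bounded_clinear T" "\<And>x. T (P x) = P (T x)" for T x
    proof -
      note linT = bounded_clinearD[OF T(1)]
      have "T (R x) = R (T x)" for x
        by (simp add: R_def linT T(2))
      from Y(4)[OF T(1) this] show ?thesis
        by (simp add: S_def linT)
    qed
  qed
qed

text \<open>\<open>Q\<close> commutes with its square \<open>P\<close>, hence with \<open>S\<close>,
  so \<open>S + Q\<close> kills \<open>z = (S - Q) x\<close>. By positivity \<open>S\<close> and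
  \<open>Q\<close> each kill \<open>z\<close>, and moving \<open>S - Q\<close> across the inner
  product gives \<open>cinner z z = 0\<close>.\<close>

lemma positive_sqrt_unique:
  assumes S: "positive_op S" "\<And>x. S (S x) = P x"
    and comm: "\<And>T x. bounded_clinear T \<Longrightarrow> (\<And>x. T (P x) = P (T x)) \<Longrightarrow> T (S x) = S (T x)"
    and Q: "positive_op Q" "\<And>x. Q (Q x) = P x"
  shows "Q = S"
proof
  fix x
  note linS = bounded_clinearD[OF positive_op_bounded_clinear[OF S(1)]]
  note linQ = bounded_clinearD[OF positive_op_bounded_clinear[OF Q(1)]]
  have QS: "Q (S x) = S (Q x)" for x
    by (rule comm[OF positive_op_bounded_clinear[OF Q(1)]]) (metis Q(2))
  define z where "z = S x - Q x"
  have "S z + Q z = 0"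
    by (simp add: z_def linS linQ S(2) Q(2) QS)
  then have "cinner (S z) z + cinner (Q z) z = 0"
    by (simp flip: cinner_add_left)
  then have "Re (cinner (S z) z) + Re (cinner (Q z) z) = 0"
    by (simp flip: plus_complex.simps)
  then have "Re (cinner (S z) z) = 0" "Re (cinner (Q z) z) = 0"
    using positive_op_Re[OF S(1), of z] positive_op_Re[OF Q(1), of z] by linarith+
  then have "S z = 0" "Q z = 0"
    using positive_op_eq_zero S(1) Q(1) by blast+
  moreover have "cinner z z = cinner (S z) x - cinner (Q z) x"
    using positive_op_hermitian[OF S(1), of z x] positive_op_hermitian[OF Q(1), of z x]
    by (simp add: z_def cinner_diff_right)
  ultimately have "cinner z z = 0"
    by simp
  then have "z = 0"
    by (simp only: cinner_eq_zero_iff)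
  then show "Q x = S x" by (simp add: z_def)
qed

text \<open>Any positive square root equals the constructed one. It therefore inherits the
  commutation property, which is what lets a self-adjoint \<open>B\<close> commute with a positive
  root of its square.\<close>

lemma op_sqrt_eqI:
  assumes "positive_op S" "S \<circ> S = P"
  shows "op_sqrt P = S"
    and "bounded_clinear T \<Longrightarrow> (\<And>x. T (P x) = P (T x)) \<Longrightarrow> T (S x) = S (T x)"
proof -
  have PS: "P x = S (S x)" for x
    using assms(2) by auto
  have herm: "cinner (P x) y = cinner (S x) (S y)" for x y
    by (simp add: PS positive_op_hermitian[OF assms(1)])
  have "positive_op P"
  proof (rule positive_opI)
    show "bounded_clinear P"
      using bounded_clinear_compose[of S S] positive_op_bounded_clinear[OF assms(1)]
      by (simp add: PS[abs_def])
  qed (auto simp: herm cinner_ge_zero Im_cinner_self)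
  then obtain S' where S': "positive_op S'" "\<And>x. S' (S' x) = P x"
    "\<And>T x. bounded_clinear T \<Longrightarrow> (\<And>x. T (P x) = P (T x)) \<Longrightarrow> T (S' x) = S' (T x)"
    by (rule positive_sqrt_exists) blast
  have unique: "Q = S'" if "positive_op Q" "Q \<circ> Q = P" for Q
    using positive_sqrt_unique[OF S'] that by (metis comp_apply)
  have "S = S'" by (rule unique[OF assms])
  then show "bounded_clinear T \<Longrightarrow> (\<And>x. T (P x) = P (T x)) \<Longrightarrow> T (S x) = S (T x)"
    using S'(3) by blast
  show "op_sqrt P = S"
    unfolding op_sqrt_def using assms unique by (intro the_equality) auto
qed

lemma op_sqrt:
  assumes "positive_op P"
  shows positive_op_sqrt: "positive_op (op_sqrt P)"
    and op_sqrt_square: "op_sqrt P (op_sqrt P x) = P x"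
proof -
  obtain S where "positive_op S" "\<And>x. S (S x) = P x"
    using positive_sqrt_exists[OF assms] by metis
  then have S: "positive_op S" "S \<circ> S = P"
    by auto
  then show "positive_op (op_sqrt P)" "op_sqrt P (op_sqrt P x) = P x"
    using op_sqrt_eqI(1)[OF S] by auto
qed

lemma op_abs:
  assumes T: "bounded_clinear T"
  shows positive_op_abs: "positive_op (op_abs T)"
    and op_abs_square: "op_abs T (op_abs T x) = cadjoint T (T x)"
proof -
  have "positive_op (cadjoint T \<circ> T)"
    unfolding comp_def
  proof (rule positive_opI)
    show "bounded_clinear (\<lambda>x. cadjoint T (T x))"
      by (rule bounded_clinear_compose[OF bounded_clinear_cadjoint[OF T] T])
  qed (auto simp: cinner_cadjoint_left[OF T] cinner_ge_zero Im_cinner_self)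
  from op_sqrt[OF this] show "positive_op (op_abs T)" "op_abs T (op_abs T x) = cadjoint T (T x)"
    by (auto simp: op_abs_def)
qed

subsection \<open>The mixed Schwarz inequality\<close>

text \<open>With \<open>E = B + S\<close> we have \<open>E\<^sup>2 = 2 S E\<close>, so \<open>E\<close> is positive on its own range. If \<open>F\<close> is the
  square root of \<open>E\<^sup>2\<close>, then \<open>E = - F\<close> on the range of \<open>F - E\<close>, which forces \<open>F = E\<close>.\<close>

lemma hermitian_plus_abs_positive:
  assumes B: "bounded_clinear B" "\<And>x y. cinner (B x) y = cinner x (B y)"
    and S: "positive_op S" "\<And>x. S (S x) = B (B x)"
  shows "positive_op (\<lambda>x. B x + S x)"
proof -
  define E where "E x = B x + S x" for x
  have bE: "bounded_clinear E"
    unfolding E_def by (intro bounded_clinear_plus B(1) positive_op_bounded_clinear S(1))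
  note linB = bounded_clinearD[OF B(1)]
  note linS = bounded_clinearD[OF positive_op_bounded_clinear[OF S(1)]]
  note linE = bounded_clinearD[OF bE]
  have "S \<circ> S = (\<lambda>x. B (B x))" using S(2) by auto
  note comm = op_sqrt_eqI(2)[OF S(1) this B(1) refl]
  have SE: "S (E x) = E (S x)" for x
    by (simp add: E_def linS comm)
  \<comment> \<open>As \<open>S\<close> and \<open>B\<close> commute and have equal squares,
    \<open>(B + S)\<^sup>2 = 2 S\<^sup>2 + 2 S B\<close>.\<close>
  have EE: "E (E x) = 2 *\<^sub>R S (E x)" for x
    by (simp add: E_def linS linB S(2) comm scaleR_2)
  have Eherm: "cinner (E x) y = cinner x (E y)" for x y
    by (simp add: E_def cinner_simps B(2) positive_op_hermitian[OF S(1)])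
  have "positive_op (\<lambda>x. E (E x))"
    by (rule positive_opI)
      (auto intro: bounded_clinear_compose bE simp: Eherm[of "E _"] cinner_ge_zero Im_cinner_self)
  then obtain F where F: "positive_op F" "\<And>x. F (F x) = E (E x)"
    "\<And>T x. bounded_clinear T \<Longrightarrow> (\<And>x. T (E (E x)) = E (E (T x))) \<Longrightarrow> T (F x) = F (T x)"
    by (rule positive_sqrt_exists) blast
  have EF: "E (F x) = F (E x)" for x
    by (rule F(3)[OF bE]) simp
  note linF = bounded_clinearD[OF positive_op_bounded_clinear[OF F(1)]]
  have "F x = E x" for x
  proof -
    define z where "z = F x - E x"
    have Ez: "E z = - F z"
      by (simp add: z_def linE linF F(2) EF)
    have FEz: "F (E z) = - E (E z)"
      using EF[of z] linE(3)[of 0 "F z"] by (simp add: Ez linE)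
    \<comment> \<open>A nonpositive number equals a nonnegative one, so both vanish.\<close>
    have "- Re (cinner (F (E z)) (E z)) = 2 * Re (cinner (S (E z)) (E z))"
      unfolding FEz EE by (simp add: cinner_simps cinner_minus_left)
    then have "Re (cinner (F (E z)) (E z)) = 0"
      using positive_op_Re[OF F(1), of "E z"] positive_op_Re[OF S(1), of "E z"] by linarith
    then have "F (E z) = 0"
      by (rule positive_op_eq_zero[OF F(1)])
    then have "cinner (E z) (E z) = 0"
      using FEz by (simp add: Eherm[of z])
    then have "E z = 0" by (simp add: cinner_eq_zero_iff)
    then have "F z = 0" using Ez by simp
    have "cinner z z = cinner (F z) x - cinner (E z) x"
      using positive_op_hermitian[OF F(1), of z x] Eherm[of z x]
      by (simp add: z_def cinner_diff_right)
    then have "z = 0"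
      using \<open>E z = 0\<close> \<open>F z = 0\<close> by (simp add: cinner_eq_zero_iff)
    then show ?thesis by (simp add: z_def)
  qed
  then have "E = F" by auto
  then show ?thesis
    using F(1) by (simp add: E_def[abs_def])
qed

section \<open>Maps into and out of the direct sum\<close>

lemma bounded_clinear_Pair:
  "bounded_clinear S \<Longrightarrow> bounded_clinear T \<Longrightarrow> bounded_clinear (\<lambda>x. (S x, T x))"
  by (auto simp: bounded_clinear_def scaleC_prod_def intro: bounded_linear_Pair)

lemma bounded_clinear_fst: "bounded_clinear fst" and bounded_clinear_snd: "bounded_clinear snd"
  by (auto simp: bounded_clinear_def scaleC_prod_def bounded_linear_fst bounded_linear_snd)

text \<open>Apply the Cauchy-Schwarz inequality to the positive block operator with diagonal entries
  \<open>|T|\<close>, \<open>|T\<^sup>*|\<close> and off-diagonal entries \<open>T\<^sup>*\<close>, \<open>T\<close>.\<close>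

lemma mixed_Schwarz:
  fixes T :: "'a::chilbert_space \<Rightarrow> 'a"
  assumes T: "bounded_clinear T"
  shows "(cmod (cinner (T x) y))\<^sup>2 \<le>
    Re (cinner (op_abs T x) x) * Re (cinner (op_abs (cadjoint T) y) y)"
proof -
  define B where "B z = (cadjoint T (snd z), T (fst z))" for z
  define S where "S z = (op_abs T (fst z), op_abs (cadjoint T) (snd z))" for z
  note T' = bounded_clinear_cadjoint[OF T]
  note abs = positive_op_abs[OF T] positive_op_abs[OF T']
  have bB: "bounded_clinear B"
    unfolding B_def
    by (intro bounded_clinear_Pair bounded_clinear_compose[OF T'] bounded_clinear_compose[OF T]
        bounded_clinear_fst bounded_clinear_snd)
  have "positive_op S"
  proof (rule positive_opI)
    show "bounded_clinear S"
      unfolding S_def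
      by (intro bounded_clinear_Pair bounded_clinear_fst bounded_clinear_snd
          bounded_clinear_compose[OF abs(1)[THEN positive_op_bounded_clinear]]
          bounded_clinear_compose[OF abs(2)[THEN positive_op_bounded_clinear]])
  qed (auto simp: S_def cinner_prod_def positive_op_Re positive_op_Im abs)
  moreover have "cinner (B z) w = cinner z (B w)" for z w
    by (simp add: B_def cinner_prod_def cinner_cadjoint_left cinner_cadjoint_right T)
  \<comment> \<open>Both squares are diagonal with entries \<open>T\<^sup>* T\<close> and
    \<open>T T\<^sup>*\<close>; the second uses \<open>T\<^sup>*\<^sup>* = T\<close>.\<close>
  moreover have "S (S z) = B (B z)" for z
    by (simp add: S_def B_def op_abs_square T T' cadjoint_cadjoint)
  ultimately have "positive_op (\<lambda>z. B z + S z)"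
    using hermitian_plus_abs_positive[OF bB] by blast
  from positive_op_Cauchy_Schwarz[OF this, of "(x, 0)" "(0, y)"] show ?thesis
    by (simp add: B_def S_def cinner_prod_def bounded_clinearD[OF T] bounded_clinearD[OF T']
        abs[THEN positive_op_bounded_clinear, THEN bounded_clinear_zero])
qed

subsection \<open>Berezin numbers of block operators\<close>

lemma norm_normalized_le: "norm (normalized v) \<le> 1"
  by (cases "v = 0") (simp_all add: normalized_def)

lemma normalized_scaleR: "norm v *\<^sub>R normalized v = v"
  by (cases "v = 0") (simp_all add: normalized_def)

text \<open>One bound for all pairs of vectors shows that the suprema in \<open>ber\<close> and
  \<open>ber_norm\<close> are over sets bounded above.\<close>

lemma cinner_normalized_bounded:
  assumes "bounded_clinear (T :: 'a::chilbert_space \<Rightarrow> 'a)"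
  obtains K where "\<And>u v. cmod (cinner (T (normalized u)) (normalized v)) \<le> K"
proof -
  obtain K where K: "0 \<le> K" "\<And>x. norm (T x) \<le> norm x * K"
    using bounded_linear.nonneg_bounded[OF bounded_clinearD(1)[OF assms]] by blast
  have "cmod (cinner (T (normalized u)) (normalized v)) \<le> K" for u v
  proof -
    have "norm (T (normalized u)) * norm (normalized v) \<le> (1 * K) * 1"
      using order_trans[OF K(2) mult_right_mono[OF norm_normalized_le K(1)]] K(1)
      by (intro mult_mono norm_normalized_le) auto
    then show ?thesis
      using cinner_Cauchy_Schwarz[of "T (normalized u)" "normalized v"] by simp
  qed
  then show thesis by (rule that)
qed

lemma ber_upper:
  assumes "bounded_clinear T" "l \<in> X"
  shows "cmod (cinner (T (normalized (k l))) (normalized (k l))) \<le> ber X k T"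
proof -
  obtain K where "\<And>u v. cmod (cinner (T (normalized u)) (normalized v)) \<le> K"
    using cinner_normalized_bounded[OF assms(1)] by blast
  then show ?thesis
    unfolding ber_def using assms(2) by (intro cSUP_upper bdd_aboveI2[of _ _ K]) auto
qed

lemma ber_norm_upper:
  assumes "bounded_clinear T" "l \<in> X" "m \<in> X"
  shows "cmod (cinner (T (normalized (k l))) (normalized (k m))) \<le> ber_norm X k T"
proof -
  obtain K where K: "\<And>u v. cmod (cinner (T (normalized u)) (normalized v)) \<le> K"
    using cinner_normalized_bounded[OF assms(1)] by blast
  have "(\<lambda>(l, m). cmod (cinner (T (normalized (k l))) (normalized (k m)))) (l, m) \<le> ber_norm X k T"
    unfolding ber_norm_def
    using assms(2,3) K by (intro cSUP_upper bdd_aboveI2[of _ _ K]) auto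
  then show ?thesis by simp
qed

text \<open>Cauchy-Schwarz for the plane vectors with entries the roots of \<open>p\<close>,
  \<open>s\<close> and of \<open>q\<close>, \<open>r\<close>. The grouping matters: in the
  application \<open>p\<close> and \<open>s\<close> are forms at one vector, \<open>q\<close> and
  \<open>r\<close> at the other.\<close>

lemma cross_terms_le:
  fixes p q r s :: real
  assumes "x\<^sup>2 \<le> p * q" "y\<^sup>2 \<le> r * s" "0 \<le> p" "0 \<le> q" "0 \<le> r" "0 \<le> s"
  shows "x + y \<le> sqrt ((p + s) * (q + r))"
proof -
  have "x \<le> sqrt p * sqrt q" "y \<le> sqrt s * sqrt r"
    using assms by (simp_all add: real_le_rsqrt mult.commute flip: real_sqrt_mult)
  moreover have "sqrt p * sqrt q + sqrt s * sqrt r \<le> sqrt ((p + s) * (q + r))"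
  proof (rule real_le_rsqrt)
    have "0 \<le> (sqrt p * sqrt r - sqrt s * sqrt q)\<^sup>2" by simp
    then show "(sqrt p * sqrt q + sqrt s * sqrt r)\<^sup>2 \<le> (p + s) * (q + r)"
      using assms(3-) by (simp add: power2_sum power2_diff power_mult_distrib algebra_simps)
  qed
  ultimately show ?thesis by linarith
qed

text \<open>The right-hand side is the larger eigenvalue of the symmetric matrix with diagonal
  \<open>\<alpha>\<close>, \<open>\<beta>\<close> and off-diagonal entry \<open>c / 2\<close>.\<close>

lemma quadratic_form_le:
  fixes a b \<alpha> \<beta> c :: real
  assumes "a\<^sup>2 + b\<^sup>2 = 1"
  shows "a\<^sup>2 * \<alpha> + b\<^sup>2 * \<beta> + a * b * c \<le> 1 / 2 * (\<alpha> + \<beta> + sqrt ((\<alpha> - \<beta>)\<^sup>2 + c\<^sup>2))"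
proof -
  \<comment> \<open>Double angle: for \<open>a = cos t\<close>, \<open>b = sin t\<close> these are
    the squares of \<open>cos (2 t)\<close> and \<open>sin (2 t)\<close>.\<close>
  have one: "(a\<^sup>2 - b\<^sup>2)\<^sup>2 + (2 * a * b)\<^sup>2 = 1"
    using arg_cong[OF assms, of "\<lambda>t. t\<^sup>2"] by (simp add: power2_eq_square algebra_simps)
  have "((a\<^sup>2 - b\<^sup>2) * (\<alpha> - \<beta>) + (2 * a * b) * c)\<^sup>2 \<le>
      ((a\<^sup>2 - b\<^sup>2)\<^sup>2 + (2 * a * b)\<^sup>2) * ((\<alpha> - \<beta>)\<^sup>2 + c\<^sup>2)"
  proof -
    have CS: "(p * q + r * s)\<^sup>2 \<le> (p\<^sup>2 + r\<^sup>2) * (q\<^sup>2 + s\<^sup>2)" for p q r s :: real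
      using zero_le_power2[of "p * s - r * q"] by (simp add: power2_eq_square algebra_simps)
    show ?thesis by (rule CS)
  qed
  then have "(a\<^sup>2 - b\<^sup>2) * (\<alpha> - \<beta>) + (2 * a * b) * c \<le> sqrt ((\<alpha> - \<beta>)\<^sup>2 + c\<^sup>2)"
    unfolding one by (intro real_le_rsqrt) simp
  moreover have "2 * (a\<^sup>2 * \<alpha> + b\<^sup>2 * \<beta>) = (\<alpha> + \<beta>) + (a\<^sup>2 - b\<^sup>2) * (\<alpha> - \<beta>)"
  proof -
    have b: "b\<^sup>2 = 1 - a\<^sup>2" using assms by simp
    show ?thesis unfolding b by (simp add: algebra_simps)
  qed
  ultimately show ?thesis by (simp add: mult.assoc)
qed

text \<open>Mixed Schwarz for \<open>S\<close> and \<open>T\<close> yields two forms at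
  \<open>v\<close> and two at \<open>u\<close>. Each pair adds up to the form of a sum of absolute
  values at a single normalised kernel, which the Berezin norm bounds by taking equal
  indices.\<close>

lemma ber_off_diagonal_le:
  fixes k :: "'w \<Rightarrow> 'h::chilbert_space"
  assumes S: "bounded_clinear S" and T: "bounded_clinear T" and lm: "l \<in> \<Omega>" "m \<in> \<Omega>"
  defines "u \<equiv> normalized (k l)" and "v \<equiv> normalized (k m)"
  shows "cmod (cinner (S v) u) + cmod (cinner (T u) v) \<le>
    sqrt (ber_norm \<Omega> k (\<lambda>x. op_abs S x + op_abs (cadjoint T) x) *
      ber_norm \<Omega> k (\<lambda>x. op_abs T x + op_abs (cadjoint S) x))"
proof -
  have le: "Re (cinner (op_abs P (normalized (k i))) (normalized (k i))) +
        Re (cinner (op_abs (cadjoint Q) (normalized (k i))) (normalized (k i))) \<le>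
      ber_norm \<Omega> k (\<lambda>x. op_abs P x + op_abs (cadjoint Q) x)"
    if "bounded_clinear P" "bounded_clinear Q" "i \<in> \<Omega>" for P Q i
  proof -
    have "bounded_clinear (\<lambda>x. op_abs P x + op_abs (cadjoint Q) x)"
      using that
      by (auto intro!: bounded_clinear_plus positive_op_abs[THEN positive_op_bounded_clinear]
          bounded_clinear_cadjoint)
    from order_trans[OF complex_Re_le_cmod ber_norm_upper[OF this that(3) that(3), of k]]
    show ?thesis by (simp add: cinner_add_left)
  qed
  note pos = positive_op_Re[OF positive_op_abs]
  note bS' = bounded_clinear_cadjoint[OF S] and bT' = bounded_clinear_cadjoint[OF T]
  have "cmod (cinner (S v) u) + cmod (cinner (T u) v) \<le>
    sqrt ((Re (cinner (op_abs S v) v) + Re (cinner (op_abs (cadjoint T) v) v)) *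
      (Re (cinner (op_abs (cadjoint S) u) u) + Re (cinner (op_abs T u) u)))"
    by (rule cross_terms_le[OF mixed_Schwarz[OF S] mixed_Schwarz[OF T]])
      (intro pos S T bS' bT')+
  also have "\<dots> \<le> sqrt (ber_norm \<Omega> k (\<lambda>x. op_abs S x + op_abs (cadjoint T) x) *
      ber_norm \<Omega> k (\<lambda>x. op_abs T x + op_abs (cadjoint S) x))"
  proof (intro real_sqrt_le_mono mult_mono)
    show le1: "Re (cinner (op_abs S v) v) + Re (cinner (op_abs (cadjoint T) v) v) \<le>
        ber_norm \<Omega> k (\<lambda>x. op_abs S x + op_abs (cadjoint T) x)"
      unfolding v_def by (rule le[OF S T lm(2)])
    show "Re (cinner (op_abs (cadjoint S) u) u) + Re (cinner (op_abs T u) u) \<le>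
        ber_norm \<Omega> k (\<lambda>x. op_abs T x + op_abs (cadjoint S) x)"
      unfolding u_def using le[OF T S lm(1)] by (simp add: add.commute)
    have nonneg: "0 \<le> Re (cinner (op_abs S v) v) + Re (cinner (op_abs (cadjoint T) v) v)"
      by (intro add_nonneg_nonneg pos S bT')
    show "0 \<le> ber_norm \<Omega> k (\<lambda>x. op_abs S x + op_abs (cadjoint T) x)"
      using nonneg le1 by linarith
    show "0 \<le> Re (cinner (op_abs (cadjoint S) u) u) + Re (cinner (op_abs T u) u)"
      by (intro add_nonneg_nonneg pos T bS')
  qed
  finally show ?thesis .
qed

theorem corollary2p10:
  fixes \<Omega> :: "'w set"
    and ev :: "'h::chilbert_space \<Rightarrow> 'w \<Rightarrow> complex"
    and k :: "'w \<Rightarrow> 'h"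
    and A11 A12 A21 A22 :: "'h \<Rightarrow> 'h"
    and A :: "'h \<times> 'h \<Rightarrow> 'h \<times> 'h"
  assumes "rkhs \<Omega> ev"
    and "k = rkernel ev"
    and "bounded_clinear A11" "bounded_clinear A12" "bounded_clinear A21" "bounded_clinear A22"
    and "bounded_clinear A"
    and "A = block_op A11 A12 A21 A22"
  shows "ber (\<Omega> \<times> \<Omega>) (sum_kernel k) A \<le>
    1 / 2 * (ber \<Omega> k A11 + ber \<Omega> k A22
      + sqrt ((ber \<Omega> k A11 - ber \<Omega> k A22)\<^sup>2
          + ber_norm \<Omega> k (\<lambda>x. op_abs A12 x + op_abs (cadjoint A21) x)
            * ber_norm \<Omega> k (\<lambda>x. op_abs A21 x + op_abs (cadjoint A12) x)))"
proof -
  define N where "N = ber_norm \<Omega> k (\<lambda>x. op_abs A12 x + op_abs (cadjoint A21) x)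
    * ber_norm \<Omega> k (\<lambda>x. op_abs A21 x + op_abs (cadjoint A12) x)"
  define \<alpha> \<beta> where "\<alpha> = ber \<Omega> k A11" and "\<beta> = ber \<Omega> k A22"
  note lin = bounded_clinearD(5)[OF assms(3)] bounded_clinearD(5)[OF assms(4)]
    bounded_clinearD(5)[OF assms(5)] bounded_clinearD(5)[OF assms(6)]
  have "cmod (cinner (A (normalized (k l, k m))) (normalized (k l, k m))) \<le>
      1 / 2 * (\<alpha> + \<beta> + sqrt ((\<alpha> - \<beta>)\<^sup>2 + N))" if lm: "l \<in> \<Omega>" "m \<in> \<Omega>" for l m
  proof -
    define n where "n = norm (k l, k m)"
    define a b where "a = norm (k l) / n" and "b = norm (k m) / n"
    define u v where "u = normalized (k l)" and "v = normalized (k m)"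
    have "k l \<noteq> 0"
      using rkhs.rkernel_nonzero[OF assms(1) lm(1)] by (simp add: assms(2))
    then have "n > 0" by (simp add: n_def zero_prod_def)
    have "n\<^sup>2 = (norm (k l))\<^sup>2 + (norm (k m))\<^sup>2"
      by (simp add: n_def norm_prod_def)
    then have "a\<^sup>2 + b\<^sup>2 = n\<^sup>2 / n\<^sup>2"
      by (simp only: a_def b_def power_divide add_divide_distrib)
    then have ab: "a\<^sup>2 + b\<^sup>2 = 1"
      using \<open>n > 0\<close> by simp
    have nonneg: "0 \<le> a" "0 \<le> b"
      using \<open>n > 0\<close> by (simp_all add: a_def b_def)
    \<comment> \<open>The joint normalisation splits into unit directions weighted by each
      component's share of the norm \<open>n\<close>.\<close>
    have w: "normalized (k l, k m) = (a *\<^sub>R u, b *\<^sub>R v)"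
      using normalized_scaleR[of "k l"] normalized_scaleR[of "k m"]
      by (simp add: normalized_def[of "(k l, k m)"] a_def b_def u_def v_def divide_inverse_commute
          flip: n_def scaleR_scaleR)
    have sq: "0 \<le> a\<^sup>2" "0 \<le> b\<^sup>2" "0 \<le> a * b" using nonneg by auto
    have off: "cmod (cinner (A12 v) u) + cmod (cinner (A21 u) v) \<le> sqrt N"
      unfolding N_def u_def v_def by (rule ber_off_diagonal_le[OF assms(4,5) lm])
    have d1: "cmod (cinner (A11 u) u) \<le> \<alpha>" and d2: "cmod (cinner (A22 v) v) \<le> \<beta>"
      unfolding u_def v_def \<alpha>_def \<beta>_def by (intro ber_upper assms lm)+
    have "cinner (A (normalized (k l, k m))) (normalized (k l, k m)) =
        of_real (a\<^sup>2) * cinner (A11 u) u + of_real (b\<^sup>2) * cinner (A22 v) v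
        + of_real (a * b) * (cinner (A12 v) u + cinner (A21 u) v)"
      by (simp add: w assms(8) block_op_def cinner_prod_def lin cinner_simps power2_eq_square
          algebra_simps)
    also have "cmod \<dots> \<le> a\<^sup>2 * cmod (cinner (A11 u) u) + b\<^sup>2 * cmod (cinner (A22 v) v)
        + a * b * cmod (cinner (A12 v) u + cinner (A21 u) v)"
      using sq by (intro order_trans[OF norm_triangle_ineq] add_mono)
        (simp_all add: norm_mult norm_power nonneg)
    also have "\<dots> \<le> a\<^sup>2 * \<alpha> + b\<^sup>2 * \<beta> + a * b * sqrt N"
      using sq d1 d2 order_trans[OF norm_triangle_ineq off]
      by (intro add_mono mult_left_mono) auto
    also have "\<dots> \<le> 1 / 2 * (\<alpha> + \<beta> + sqrt ((\<alpha> - \<beta>)\<^sup>2 + (sqrt N)\<^sup>2))"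
      by (rule quadratic_form_le[OF ab])
    also have "(sqrt N)\<^sup>2 = N"
    proof (rule real_sqrt_pow2)
      \<comment> \<open>The real \<open>sqrt\<close> is negative on negative numbers, so a lower
        bound on \<open>sqrt N\<close> decides the sign of \<open>N\<close>; \<open>off\<close>
        provides one.\<close>
      have "0 \<le> sqrt N"
        using off norm_ge_zero[of "cinner (A12 v) u"] norm_ge_zero[of "cinner (A21 u) v"]
        by linarith
      then show "0 \<le> N" by simp
    qed
    finally show ?thesis .
  qed
  moreover have "\<Omega> \<noteq> {}"
    by (rule rkhs.nonempty[OF assms(1)])
  ultimately show ?thesis
    unfolding ber_def[of "\<Omega> \<times> \<Omega>"] N_def[symmetric] \<alpha>_def[symmetric] \<beta>_def[symmetric]
    by (intro cSUP_least) (auto simp: sum_kernel_def)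
qed

end
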